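(* For every integer $n \geq 1$ there exists a generating set $C$ of $A_4^n$ of minimum size (that is, $|C| = \mathrm{rank}(A_4^n)$) such that $\mathrm{diam}(A_4^n, C) \leq 10n$.
   Context: $A_4$ is the alternating group on 4 letters and $A_4^n$ is its $n$-fold direct power. A subset $A$ of a finite group $G$ is a generating set of $G$ if every element of $G$ is a product of elements of $A$ (inverses are not needed because $G$ is finite). The rank $\mathrm{rank}(G)$ is the smallest cardinality of a generating set of $G$. For a generating set $A$ of $G$ and $g \in G$, the length $l_A(g)$ is the minimum length of a word in elements of $A$ (no inverses allowed) whose product is $g$, with $l_A(1)=0$. The diameter is $\mathrm{diam}(G,A) := \max\{l_A(g) : g \in G\}$. *)

theory Defs
  imports "HOL-Algebra.Sym_Groups" "HOL-Algebra.Product_Groups"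
begin

definition word_prod :: "('a, 'b) monoid_scheme \<Rightarrow> 'a list \<Rightarrow> 'a"
  where "word_prod G ws = foldr (\<otimes>\<^bsub>G\<^esub>) ws \<one>\<^bsub>G\<^esub>"

text \<open>Generation and length use positive words only, unlike \<^const>\<open>generate\<close>, which also
  closes under inverses. The notions below are meant for finite groups.\<close>

definition generating_set :: "('a, 'b) monoid_scheme \<Rightarrow> 'a set \<Rightarrow> bool"
  where "generating_set G A \<longleftrightarrow>
    A \<subseteq> carrier G \<and> (\<forall>g \<in> carrier G. \<exists>ws. set ws \<subseteq> A \<and> word_prod G ws = g)"

definition group_rank :: "('a, 'b) monoid_scheme \<Rightarrow> nat"
  where "group_rank G = (LEAST k. \<exists>A. finite A \<and> generating_set G A \<and> card A = k)"

text \<open>The empty word is allowed, so the identity has length 0.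
  The length is meaningful only for elements that are products of elements of \<open>A\<close>.\<close>

definition word_length :: "('a, 'b) monoid_scheme \<Rightarrow> 'a set \<Rightarrow> 'a \<Rightarrow> nat"
  where "word_length G A g =
    (LEAST k. \<exists>ws. set ws \<subseteq> A \<and> word_prod G ws = g \<and> length ws = k)"

definition diam :: "('a, 'b) monoid_scheme \<Rightarrow> 'a set \<Rightarrow> nat"
  where "diam G A = Max {word_length G A g | g. g \<in> carrier G}"

definition alt4_power :: "nat \<Rightarrow> (nat \<Rightarrow> nat \<Rightarrow> nat) monoid"
  where "alt4_power n = product_group {1..n} (\<lambda>_. alt_group 4)"

end

theory Submission
  imports Defs
begin

text \<open>
  Write \<open>x = (1 2 3)\<close> and \<open>v = (1 2)(3 4)\<close>; every element of \<open>A\<^sub>4\<close> has the form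
  \<open>x\<^sup>a v\<^sup>e x\<^sup>b\<close>. For \<open>n \<ge> 2\<close> let \<open>c\<^sub>j\<close> have \<open>x\<close> in coordinate \<open>j\<close>, \<open>v\<close> in the cyclically
  next coordinate, and \<open>1\<close> elsewhere. Since \<open>x\<close> has order 3 and \<open>v\<close> order 2, an exponent of \<open>c\<^sub>j\<close>
  between 0 and 5 prescribes the powers of \<open>x\<close> and of \<open>v\<close> independently. In a product
  \<open>c\<^sub>1\<^bsup>m(1)\<^esup> \<cdots> c\<^sub>n\<^bsup>m(n)\<^esup> c\<^sub>1\<^bsup>k(1)\<^esup> \<cdots> c\<^sub>n\<^bsup>k(n)\<^esup>\<close> coordinate \<open>i \<ge> 2\<close> reads
  \<open>v\<^sup>d x\<^sup>a v\<^sup>e x\<^sup>b\<close> and coordinate 1 reads \<open>x\<^sup>a v\<^sup>e x\<^sup>b v\<^sup>d\<close>, so with \<open>d = 0\<close> everything is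
  reached by words of length at most \<open>5n + 5n\<close>. The \<open>c\<^sub>j\<close> are as few as possible because
  \<open>A\<^sub>4\<^sup>n\<close> maps onto \<open>C\<^sub>3\<^sup>n\<close>. For \<open>n = 1\<close> the pair \<open>x, v\<close> serves, as \<open>A\<^sub>4\<close> is not cyclic.
\<close>

section \<open>Words\<close>

text \<open>Words are evaluated among all self-maps, so the laws below need no carrier
  hypotheses.\<close>

primrec comps :: "('a \<Rightarrow> 'a) list \<Rightarrow> 'a \<Rightarrow> 'a"
  where "comps [] = id" | "comps (f # fs) = f \<circ> comps fs"

lemma comps_append: "comps (fs @ gs) = comps fs \<circ> comps gs"
  by (induction fs) (simp_all add: o_assoc)

lemma comps_replicate: "comps (replicate k f) = f ^^ k"
  by (induction k) simp_all

lemma comps_eq_id: "(\<And>f. f \<in> set fs \<Longrightarrow> f = id) \<Longrightarrow> comps fs = id"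
  by (induction fs) simp_all

lemma comps_concat_replicate:
  "comps (concat (map (\<lambda>j. replicate (m j) (f j)) js)) = comps (map (\<lambda>j. f j ^^ m j) js)"
  by (induction js) (simp_all add: comps_append comps_replicate o_assoc)

lemma word_prod_closed:
  assumes "monoid G" "set ws \<subseteq> carrier G"
  shows "word_prod G ws \<in> carrier G"
  using assms(2)
  by (induction ws)
     (auto simp: word_prod_def monoid.one_closed[OF assms(1)] monoid.m_closed[OF assms(1)])

lemma word_prod_product_group:
  assumes "i \<in> I"
  shows "word_prod (product_group I G) ws i = word_prod (G i) (map (\<lambda>w. w i) ws)"
  using assms by (induction ws) (simp_all add: word_prod_def)

lemma word_prod_alt_group: "word_prod (alt_group n) ws = comps ws"
  by (induction ws) (simp_all add: word_prod_def alt_group_mult alt_group_one)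

lemma diam_le:
  assumes "finite (carrier G)" "carrier G \<noteq> {}"
    and words: "\<And>g. g \<in> carrier G \<Longrightarrow> \<exists>ws. set ws \<subseteq> A \<and> word_prod G ws = g \<and> length ws \<le> N"
  shows "diam G A \<le> N"
proof -
  have "word_length G A g \<le> N" if g: "g \<in> carrier G" for g
  proof -
    obtain ws where ws: "set ws \<subseteq> A" "word_prod G ws = g" "length ws \<le> N"
      using words[OF g] by blast
    then have "word_length G A g \<le> length ws"
      unfolding word_length_def by (intro Least_le exI[of _ ws]) simp
    with ws(3) show ?thesis by simp
  qed
  moreover have "finite {word_length G A g | g. g \<in> carrier G}"
    using assms(1) by simp
  ultimately show ?thesis
    using assms(2) unfolding diam_def by (subst Max_le_iff) auto
qed

lemma group_rank_eq_card:
  assumes "finite C" "generating_set G C"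
    and "\<And>A. finite A \<Longrightarrow> generating_set G A \<Longrightarrow> card C \<le> card A"
  shows "group_rank G = card C"
  unfolding group_rank_def using assms by (intro Least_equality) auto

lemma funpow_mod_eq_id:
  assumes "f ^^ n = id"
  shows "f ^^ (m mod n) = f ^^ m"
  using assms by (intro ext funpow_mod_eq) simp

section \<open>The group \<open>A\<^sub>4\<close>\<close>

definition alt4_x :: "nat \<Rightarrow> nat"
  where "alt4_x = transpose 1 2 \<circ> transpose 2 3"

definition alt4_v :: "nat \<Rightarrow> nat"
  where "alt4_v = transpose 1 2 \<circ> transpose 3 4"

lemma alt4_x_apply [simp]:
  "alt4_x (Suc 0) = 2" "alt4_x 2 = 3" "alt4_x 3 = Suc 0" "alt4_x 4 = 4"
  by (simp_all add: alt4_x_def transpose_def)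

lemma alt4_v_apply [simp]:
  "alt4_v (Suc 0) = 2" "alt4_v 2 = Suc 0" "alt4_v 3 = 4" "alt4_v 4 = 3"
  by (simp_all add: alt4_v_def transpose_def)

lemma alt4_x_carrier: "alt4_x \<in> carrier (alt_group 4)"
  unfolding alt_group_carrier alt4_x_def
  by (auto intro!: permutes_compose permutes_swap_id
      simp: evenperm_comp permutation_swap_id evenperm_swap)

lemma alt4_v_carrier: "alt4_v \<in> carrier (alt_group 4)"
  unfolding alt_group_carrier alt4_v_def
  by (auto intro!: permutes_compose permutes_swap_id
      simp: evenperm_comp permutation_swap_id evenperm_swap)

lemma alt4_comp_closed:
  assumes "p \<in> carrier (alt_group 4)" "q \<in> carrier (alt_group 4)"
  shows "p \<circ> q \<in> carrier (alt_group 4)"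
  using monoid.m_closed[OF group.is_monoid[OF alt_group_is_group] assms]
  by (simp add: alt_group_mult)

lemma alt4_id_carrier: "id \<in> carrier (alt_group 4)"
  by (simp add: alt_group_carrier permutes_id)

lemma alt4_funpow_closed: "p \<in> carrier (alt_group 4) \<Longrightarrow> p ^^ k \<in> carrier (alt_group 4)"
  by (induction k) (simp_all add: alt4_id_carrier alt4_comp_closed)

lemma alt4_x_cube: "alt4_x ^^ 3 = id"
  by (auto simp: fun_eq_iff alt4_x_def numeral_3_eq_3 transpose_def)

lemma alt4_v_square: "alt4_v ^^ 2 = id"
  by (auto simp: fun_eq_iff alt4_v_def numeral_2_eq_2 transpose_def)

text \<open>The point 4 separates the two sides: it goes to 1 on the left and to 3 on the
  right.\<close>

lemma alt4_not_commute: "alt4_x \<circ> alt4_v \<noteq> alt4_v \<circ> alt4_x"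
  by (auto simp: fun_eq_iff intro!: exI[of _ 4])

lemma finite_alt4: "finite (carrier (alt_group 4))"
  using finite_permutations[of "{1..4::nat}"] by (rule rev_finite_subset) (auto simp: alt_group_carrier)

text \<open>The proof counts: the products below already take 12 different value tables.\<close>

lemma alt4_normal_form:
  assumes "p \<in> carrier (alt_group 4)"
  obtains a e b where "a < 3" "e < 2" "b < 3" "p = alt4_x ^^ a \<circ> alt4_v ^^ e \<circ> alt4_x ^^ b"
proof -
  define F where "F = (\<lambda>(a, e, b). alt4_x ^^ a \<circ> alt4_v ^^ e \<circ> alt4_x ^^ b)"
  define S where "S = F ` ({0, 1, 2} \<times> {0, 1} \<times> {0, 1, 2})"
  define T where "T = (\<lambda>p :: nat \<Rightarrow> nat. [p 1, p 2, p 3, p 4])"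
  have sub: "S \<subseteq> carrier (alt_group 4)"
    unfolding S_def F_def
    by (auto intro!: alt4_comp_closed alt4_funpow_closed alt4_x_carrier alt4_v_carrier alt4_id_carrier)
  \<comment> \<open>The triples with \<open>e = 0\<close> yield only the 3 powers of
    \<open>alt4_x\<close>, which come first; the 9 triples with \<open>e = 1\<close> yield the
    remaining 9 tables.\<close>
  let ?L = "[[1,2,3,4],[2,3,1,4],[3,1,2,4],[2,1,4,3],[1,4,2,3],[4,2,1,3],
     [3,2,4,1],[2,4,3,1],[4,3,2,1],[1,3,4,2],[3,4,1,2],[4,1,3,2]] :: nat list list"
  have "alt4_x ^^ 2 = alt4_x \<circ> alt4_x"
    by (simp add: numeral_2_eq_2)
  then have "T ` S = set ?L"
    by (simp add: S_def F_def T_def insert_Times_insert) auto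
  then have "12 = card (T ` S)"
    by simp
  also have "\<dots> \<le> card S"
    by (intro card_image_le) (simp add: S_def)
  finally have "12 \<le> card S" .
  moreover have "card (carrier (alt_group 4)) = 12"
    using alt_group_card_carrier[of 4] by (simp add: fact_numeral)
  ultimately have "S = carrier (alt_group 4)"
    using sub finite_alt4 by (intro card_seteq) auto
  with assms have "p \<in> S" by simp
  then obtain a e b where "a \<in> {0, 1, 2}" "e \<in> {0, 1}" "b \<in> {0, 1, 2}" "p = F (a, e, b)"
    unfolding S_def by blast
  then show thesis
    by (intro that[of a e b]) (auto simp: F_def)
qed

text \<open>The quotient map \<open>A\<^sub>4 \<rightarrow> \<int>/3\<close> given by the action on the three splittings of
  \<open>{1, 2, 3, 4}\<close> into pairs: the splitting \<open>{1, 4}, {2, 3}\<close> has pair sums 5, 5, the other two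
  have sums 6, 4 and 7, 3, so the distance from 5 identifies the image of \<open>{1, 4}\<close>.\<close>

definition alt4_rot :: "(nat \<Rightarrow> nat) \<Rightarrow> nat"
  where "alt4_rot p = nat \<bar>int (p 1) + int (p 4) - 5\<bar>"

text \<open>\<open>alt4_rot\<close> sees only the images of 1 and 4, so 12 cases suffice.
  Geometrically, \<open>alt4_x\<close> permutes the three splittings cyclically and
  \<open>alt4_v\<close> fixes each of them.\<close>

lemma alt4_rot_generators:
  assumes "q \<in> carrier (alt_group 4)"
  shows "alt4_rot (alt4_x \<circ> q) mod 3 = (1 + alt4_rot q) mod 3"
    and "alt4_rot (alt4_v \<circ> q) = alt4_rot q"
proof -
  have q: "q permutes {1..4}"
    using assms by (simp add: alt_group_carrier)
  have "{1..4} = {1, 2, 3, 4 :: nat}"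
    by auto
  then have "q 1 \<in> {1, 2, 3, 4}" "q 4 \<in> {1, 2, 3, 4}"
    using permutes_in_image[OF q, of 1] permutes_in_image[OF q, of 4] by auto
  moreover have "q 1 \<noteq> q 4"
    using permutes_inj[OF q] by (simp add: inj_eq)
  ultimately show "alt4_rot (alt4_x \<circ> q) mod 3 = (1 + alt4_rot q) mod 3"
    "alt4_rot (alt4_v \<circ> q) = alt4_rot q"
    by (auto simp: alt4_rot_def)
qed

lemma alt4_rot_x_funpow_comp:
  assumes "q \<in> carrier (alt_group 4)"
  shows "alt4_rot (alt4_x ^^ a \<circ> q) mod 3 = (a + alt4_rot q) mod 3"
proof (induction a)
  case (Suc a)
  have "alt4_rot (alt4_x ^^ Suc a \<circ> q) mod 3 = (1 + alt4_rot (alt4_x ^^ a \<circ> q)) mod 3"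
    using alt4_rot_generators(1)[OF alt4_comp_closed[OF alt4_funpow_closed[OF alt4_x_carrier] assms]]
    by (simp only: funpow.simps comp_assoc)
  also have "\<dots> = (1 + (a + alt4_rot q)) mod 3"
    using Suc by (intro mod_add_cong refl)
  finally show ?case
    by (simp only: plus_1_eq_Suc add_Suc)
qed simp

lemma alt4_rot_v_funpow_comp:
  assumes "q \<in> carrier (alt_group 4)"
  shows "alt4_rot (alt4_v ^^ e \<circ> q) = alt4_rot q"
proof (induction e)
  case (Suc e)
  then show ?case
    using alt4_rot_generators(2)[OF alt4_comp_closed[OF alt4_funpow_closed[OF alt4_v_carrier] assms]]
    by (simp only: funpow.simps comp_assoc)
qed simp

lemma alt4_rot_id: "alt4_rot id = 0"
  by (simp add: alt4_rot_def)

lemma alt4_rot_x_funpow: "alt4_rot (alt4_x ^^ a) mod 3 = a mod 3"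
  using alt4_rot_x_funpow_comp[OF alt4_id_carrier, of a] by (simp add: alt4_rot_id)

text \<open>Left multiplication by powers of the generators is understood, so the left factor is put
  into normal form and peeled off power by power. Peeling it off \<open>id\<close> shows what it
  contributes by itself.\<close>

lemma alt4_rot_comp:
  assumes "p \<in> carrier (alt_group 4)" "q \<in> carrier (alt_group 4)"
  shows "alt4_rot (p \<circ> q) mod 3 = (alt4_rot p + alt4_rot q) mod 3"
proof -
  obtain a e b where p: "p = alt4_x ^^ a \<circ> alt4_v ^^ e \<circ> alt4_x ^^ b"
    using alt4_normal_form[OF assms(1)] by metis
  have *: "alt4_rot (p \<circ> r) mod 3 = (a + (b + alt4_rot r)) mod 3"
    if r: "r \<in> carrier (alt_group 4)" for r
  proof -
    note xr = alt4_comp_closed[OF alt4_funpow_closed[OF alt4_x_carrier, of b] r]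
    note vxr = alt4_comp_closed[OF alt4_funpow_closed[OF alt4_v_carrier, of e] xr]
    have "alt4_rot (p \<circ> r) mod 3 = (a + alt4_rot (alt4_x ^^ b \<circ> r)) mod 3"
      using alt4_rot_x_funpow_comp[OF vxr, of a] alt4_rot_v_funpow_comp[OF xr, of e]
      by (simp add: p o_assoc)
    then show ?thesis
      using mod_add_cong[OF refl alt4_rot_x_funpow_comp[OF r, of b], of a] by simp
  qed
  have "alt4_rot p mod 3 = (a + b) mod 3"
    using *[OF alt4_id_carrier] by (simp add: alt4_rot_id)
  then have "(alt4_rot p + alt4_rot q) mod 3 = (a + b + alt4_rot q) mod 3"
    by (intro mod_add_cong refl)
  with *[OF assms(2)] show ?thesis
    by (simp add: add.assoc)
qed

lemma alt4_comps_closed: "set ws \<subseteq> carrier (alt_group 4) \<Longrightarrow> comps ws \<in> carrier (alt_group 4)"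
  using word_prod_closed[OF group.is_monoid[OF alt_group_is_group]] by (simp add: word_prod_alt_group)

lemma alt4_rot_comps:
  assumes "set ws \<subseteq> carrier (alt_group 4)"
  shows "alt4_rot (comps ws) mod 3 = sum_list (map alt4_rot ws) mod 3"
  using assms
proof (induction ws)
  case (Cons w ws)
  then have "alt4_rot (comps (w # ws)) mod 3 = (alt4_rot w + alt4_rot (comps ws)) mod 3"
    using alt4_rot_comp[of w "comps ws"] alt4_comps_closed[of ws] by simp
  also have "\<dots> = (alt4_rot w + sum_list (map alt4_rot ws)) mod 3"
    using Cons by (intro mod_add_cong refl) simp
  finally show ?case
    by (simp only: list.map sum_list.Cons)
qed (simp add: alt4_rot_id)

section \<open>The rank of \<open>A\<^sub>4\<^sup>n\<close>\<close>

lemma carrier_alt4_power: "carrier (alt4_power n) = {1..n} \<rightarrow>\<^sub>E carrier (alt_group 4)"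
  by (simp add: alt4_power_def)

lemma alt4_power_is_group: "group (alt4_power n)"
  by (simp add: alt4_power_def alt_group_is_group)

lemma word_prod_alt4_power:
  "i \<in> {1..n} \<Longrightarrow> word_prod (alt4_power n) ws i = comps (map (\<lambda>w. w i) ws)"
  by (simp only: alt4_power_def word_prod_product_group word_prod_alt_group)

lemma word_prod_alt4_power_eqI:
  assumes "set ws \<subseteq> carrier (alt4_power n)" "g \<in> carrier (alt4_power n)"
    and "\<And>i. i \<in> {1..n} \<Longrightarrow> comps (map (\<lambda>w. w i) ws) = g i"
  shows "word_prod (alt4_power n) ws = g"
proof (rule PiE_ext)
  show "word_prod (alt4_power n) ws \<in> {1..n} \<rightarrow>\<^sub>E carrier (alt_group 4)"
    using word_prod_closed[OF group.is_monoid[OF alt4_power_is_group] assms(1)]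
    by (simp add: carrier_alt4_power)
  show "g \<in> {1..n} \<rightarrow>\<^sub>E carrier (alt_group 4)"
    using assms(2) by (simp add: carrier_alt4_power)
qed (simp only: word_prod_alt4_power assms(3))

text \<open>Counting replaces a dimension argument: every vector modulo 3 is a combination of the
  \<open>alt4_rot\<close> images of the generators, and there are only \<open>3 ^ card A\<close>
  choices of coefficients.\<close>

lemma alt4_power_rank_ge_n:
  assumes "finite A" and gen: "generating_set (alt4_power n) A"
  shows "n \<le> card A"
proof -
  define \<Phi> where "\<Phi> k = (\<lambda>i\<in>{1..n}. (\<Sum>a\<in>A. k a * alt4_rot (a i)) mod 3)" for k :: "_ \<Rightarrow> nat"
  have "t \<in> \<Phi> ` (A \<rightarrow>\<^sub>E {..<3})" if t: "t \<in> {1..n} \<rightarrow>\<^sub>E {..<3}" for t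
  proof -
    have "(\<lambda>i\<in>{1..n}. alt4_x ^^ t i) \<in> carrier (alt4_power n)"
      by (auto simp: carrier_alt4_power alt4_funpow_closed alt4_x_carrier)
    then obtain ws where ws: "set ws \<subseteq> A" "word_prod (alt4_power n) ws = (\<lambda>i\<in>{1..n}. alt4_x ^^ t i)"
      using gen unfolding generating_set_def by blast
    \<comment> \<open>The quotient is abelian, so only the number of occurrences of each generator
      modulo 3 matters, not their order.\<close>
    define k where "k = (\<lambda>a\<in>A. count_list ws a mod 3)"
    have "\<Phi> k = t"
    proof (rule PiE_ext)
      show "\<Phi> k \<in> {1..n} \<rightarrow>\<^sub>E {..<3}" "t \<in> {1..n} \<rightarrow>\<^sub>E {..<3}"
        using t by (auto simp: \<Phi>_def)
      fix i assume i: "i \<in> {1..n}"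
      have sub: "set (map (\<lambda>w. w i) ws) \<subseteq> carrier (alt_group 4)"
        using ws(1) gen i unfolding generating_set_def carrier_alt4_power by fastforce
      have "comps (map (\<lambda>w. w i) ws) = alt4_x ^^ t i"
        using word_prod_alt4_power[OF i, of ws] ws(2) i by simp
      then have "t i mod 3 = alt4_rot (comps (map (\<lambda>w. w i) ws)) mod 3"
        by (simp only: alt4_rot_x_funpow)
      moreover have "t i mod 3 = t i"
        using PiE_mem[OF t i] by simp
      ultimately have "t i = alt4_rot (comps (map (\<lambda>w. w i) ws)) mod 3"
        by simp
      also have "\<dots> = (\<Sum>w\<leftarrow>ws. alt4_rot (w i)) mod 3"
        using alt4_rot_comps[OF sub] by (simp add: comp_def)
      also have "(\<Sum>w\<leftarrow>ws. alt4_rot (w i)) = (\<Sum>a\<in>A. count_list ws a * alt4_rot (a i))"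
        using ws(1) assms(1) by (rule sum_list_map_eq_sum_count2)
      also have "\<dots> mod 3 = (\<Sum>a\<in>A. (count_list ws a * alt4_rot (a i)) mod 3) mod 3"
        by (simp only: mod_sum_eq)
      also have "\<dots> = (\<Sum>a\<in>A. (k a * alt4_rot (a i)) mod 3) mod 3"
        by (rule arg_cong[of _ _ "\<lambda>s. s mod 3"], rule sum.cong) (simp_all add: k_def mod_mult_left_eq)
      also have "\<dots> = \<Phi> k i"
        using i by (simp add: \<Phi>_def mod_sum_eq)
      finally show "\<Phi> k i = t i" ..
    qed
    moreover have "k \<in> A \<rightarrow>\<^sub>E {..<3}"
      by (auto simp: k_def)
    ultimately show ?thesis by blast
  qed
  then have "card ({1..n} \<rightarrow>\<^sub>E {..<3::nat}) \<le> card (\<Phi> ` (A \<rightarrow>\<^sub>E {..<3}))"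
    using assms(1) by (intro card_mono finite_imageI finite_PiE) auto
  also have "\<dots> \<le> card (A \<rightarrow>\<^sub>E {..<3::nat})"
    using assms(1) by (intro card_image_le finite_PiE) auto
  finally have "(3::nat) ^ n \<le> 3 ^ card A"
    using assms(1) by (simp add: card_PiE)
  then show ?thesis
    by simp
qed

text \<open>Powers of a single element commute, whereas \<open>alt4_x\<close> and
  \<open>alt4_v\<close> do not. This settles \<open>n = 1\<close>, where the quotient bound gives
  only 1.\<close>

lemma alt4_power_rank_ge_2:
  assumes "finite A" and gen: "generating_set (alt4_power n) A" and "n \<ge> 1"
  shows "2 \<le> card A"
proof (rule ccontr)
  assume "\<not> 2 \<le> card A"
  then have "card A \<le> 1" by simp
  \<comment> \<open>An inclusion rather than an equality, so that empty \<open>A\<close> is covered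
    too.\<close>
  then obtain a where a: "A \<subseteq> {a}"
    using assms(1) by (metis card_le_Suc0_iff_eq One_nat_def insertI1 subsetI equals0I)
  have 1: "1 \<in> {1..n}" using \<open>n \<ge> 1\<close> by simp
  have pow: "\<exists>k. p = a 1 ^^ k" if p: "p \<in> carrier (alt_group 4)" for p
  proof -
    have "(\<lambda>i\<in>{1..n}. p) \<in> carrier (alt4_power n)"
      using p by (auto simp: carrier_alt4_power)
    then obtain ws where ws: "set ws \<subseteq> A" "word_prod (alt4_power n) ws = (\<lambda>i\<in>{1..n}. p)"
      using gen unfolding generating_set_def by blast
    have "ws = replicate (length ws) a"
      using ws(1) a by (intro replicate_eqI) auto
    then have "map (\<lambda>w. w 1) ws = replicate (length ws) (a 1)"
      by (metis map_replicate)
    then have "p = a 1 ^^ length ws"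
      using word_prod_alt4_power[OF 1, of ws] ws(2) 1 by (simp add: comps_replicate)
    then show ?thesis ..
  qed
  obtain k l where "alt4_x = a 1 ^^ k" "alt4_v = a 1 ^^ l"
    using pow[OF alt4_x_carrier] pow[OF alt4_v_carrier] by blast
  then have "alt4_x \<circ> alt4_v = alt4_v \<circ> alt4_x"
    by (metis funpow_add add.commute)
  then show False
    using alt4_not_commute by simp
qed

section \<open>Short words\<close>

definition cyc_succ :: "nat \<Rightarrow> nat \<Rightarrow> nat"
  where "cyc_succ n j = (if j = n then 1 else j + 1)"

text \<open>For \<open>n = 1\<close> both special coordinates coincide and the first test hides
  \<open>alt4_v\<close>; that case gets its own generators.\<close>

definition alt4_gen :: "nat \<Rightarrow> nat \<Rightarrow> nat \<Rightarrow> nat \<Rightarrow> nat"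
  where "alt4_gen n j =
    (\<lambda>i\<in>{1..n}. if i = j then alt4_x else if i = cyc_succ n j then alt4_v else id)"

lemma alt4_gen_carrier: "alt4_gen n j \<in> carrier (alt4_power n)"
  by (auto simp: alt4_gen_def carrier_alt4_power alt4_x_carrier alt4_v_carrier alt4_id_carrier)

text \<open>Coordinate \<open>j\<close> betrays the index: only generator \<open>j\<close> has
  \<open>alt4_x\<close> there, which is neither \<open>alt4_v\<close> nor \<open>id\<close>.\<close>

lemma inj_on_alt4_gen: "inj_on (alt4_gen n) {1..n}"
proof (rule inj_onI)
  fix j k assume jk: "j \<in> {1..n}" "k \<in> {1..n}" "alt4_gen n j = alt4_gen n k"
  have "alt4_x 4 \<noteq> alt4_v 4" "alt4_x (Suc 0) \<noteq> id (Suc 0)"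
    by simp_all
  then have "alt4_x \<noteq> alt4_v" "alt4_x \<noteq> id"
    by metis+
  then show "j = k"
    using fun_cong[OF jk(3), of j] jk(1,2) by (auto simp: alt4_gen_def split: if_splits)
qed

text \<open>Chinese remainders: \<open>crt6 a e\<close> is congruent to \<open>a\<close> modulo 3 and to \<open>e\<close> modulo 2.\<close>

definition crt6 :: "nat \<Rightarrow> nat \<Rightarrow> nat"
  where "crt6 a e = (4 * a + 3 * e) mod 6"

lemma crt6_le: "crt6 a e \<le> 5"
  by (simp add: crt6_def less_Suc_eq_le[symmetric])

lemma alt4_x_funpow_crt6: "alt4_x ^^ crt6 a e = alt4_x ^^ a"
proof -
  have "crt6 a e mod 3 = (4 * a + 3 * e) mod 3"
    unfolding crt6_def by (rule mod_mod_cancel) simp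
  also have "\<dots> = a mod 3"
    by presburger
  finally have "crt6 a e mod 3 = a mod 3" .
  then show ?thesis
    using funpow_mod_eq_id[OF alt4_x_cube, of "crt6 a e"] funpow_mod_eq_id[OF alt4_x_cube, of a]
    by simp
qed

lemma alt4_v_funpow_crt6: "alt4_v ^^ crt6 a e = alt4_v ^^ e"
proof -
  have "crt6 a e mod 2 = (4 * a + 3 * e) mod 2"
    unfolding crt6_def by (rule mod_mod_cancel) simp
  also have "\<dots> = e mod 2"
    by presburger
  finally have "crt6 a e mod 2 = e mod 2" .
  then show ?thesis
    using funpow_mod_eq_id[OF alt4_v_square, of "crt6 a e"] funpow_mod_eq_id[OF alt4_v_square, of e]
    by simp
qed

text \<open>Both exponent functions are indexed by the coordinate they affect, hence
  \<open>e\<close> is taken at the cyclic successor.\<close>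

definition alt4_sweep :: "nat \<Rightarrow> (nat \<Rightarrow> nat) \<Rightarrow> (nat \<Rightarrow> nat) \<Rightarrow> (nat \<Rightarrow> nat \<Rightarrow> nat) list"
  where "alt4_sweep n a e =
    concat (map (\<lambda>j. replicate (crt6 (a j) (e (cyc_succ n j))) (alt4_gen n j)) [1..<Suc n])"

lemma set_alt4_sweep: "set (alt4_sweep n a e) \<subseteq> alt4_gen n ` {1..n}"
  by (auto simp: alt4_sweep_def)

lemma length_alt4_sweep: "length (alt4_sweep n a e) \<le> 5 * n"
proof -
  have "length (alt4_sweep n a e) = (\<Sum>j\<leftarrow>[1..<Suc n]. crt6 (a j) (e (cyc_succ n j)))"
    by (simp only: alt4_sweep_def length_concat map_map comp_def length_replicate)
  also have "\<dots> \<le> (\<Sum>j\<leftarrow>[1..<Suc n]. 5)"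
    by (rule sum_list_mono) (rule crt6_le)
  also have "\<dots> = 5 * n"
    by (simp only: sum_list_const_mult sum_list_triv length_upt) simp
  finally show ?thesis .
qed

text \<open>Only block \<open>i\<close> and the block of its cyclic predecessor touch coordinate
  \<open>i\<close>. The predecessor comes first, except that coordinate 1 has predecessor
  \<open>n\<close>, whose block is last.\<close>

lemma comps_alt4_sweep:
  assumes "n \<ge> 2" "i \<in> {1..n}"
  shows "comps (map (\<lambda>w. w i) (alt4_sweep n a e)) =
    (if i = 1 then alt4_x ^^ a i \<circ> alt4_v ^^ e i else alt4_v ^^ e i \<circ> alt4_x ^^ a i)"
proof -
  define h where "h j = alt4_gen n j i ^^ crt6 (a j) (e (cyc_succ n j))" for j
  have "map (\<lambda>w. w i) (alt4_sweep n a e) =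
      concat (map (\<lambda>j. replicate (crt6 (a j) (e (cyc_succ n j))) (alt4_gen n j i)) [1..<Suc n])"
    by (simp only: alt4_sweep_def map_concat map_map comp_def map_replicate)
  then have sweep: "comps (map (\<lambda>w. w i) (alt4_sweep n a e)) = comps (map h [1..<Suc n])"
    by (simp only: comps_concat_replicate h_def[abs_def])
  have hx: "h i = alt4_x ^^ a i"
    using assms by (simp add: h_def alt4_gen_def alt4_x_funpow_crt6)
  have hv: "h j = alt4_v ^^ e i" if "j \<noteq> i" "cyc_succ n j = i" for j
    using that assms by (simp add: h_def alt4_gen_def alt4_v_funpow_crt6)
  have "h j = id" if "j \<noteq> i" "cyc_succ n j \<noteq> i" for j
    using that assms by (simp add: h_def alt4_gen_def)
  then have h1: "comps (map h js) = id"
    if "\<And>j. j \<in> set js \<Longrightarrow> j \<noteq> i \<and> cyc_succ n j \<noteq> i" for js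
    using that by (intro comps_eq_id) auto
  show ?thesis
  proof (cases "i = 1")
    case True
    have split: "[1..<Suc n] = [1] @ [2..<n] @ [n]"
      using assms upt_conv_Cons[of 1 n] by (simp add: numeral_2_eq_2)
    have "comps (map h [2..<n]) = id"
      using True by (intro h1) (auto simp: cyc_succ_def)
    moreover have "h n = alt4_v ^^ e 1"
      using hv[of n] True assms by (simp add: cyc_succ_def)
    ultimately show ?thesis
      using hx True unfolding sweep split by (simp add: comps_append)
  next
    case False
    then obtain l where l: "i = Suc l" "l \<ge> 1"
      using assms(2) by (cases i) auto
    have split: "[1..<Suc n] = [1..<l] @ [l, Suc l] @ [Suc (Suc l)..<Suc n]"
      using l assms upt_add_eq_append[of 1 l "Suc n - l"] by (simp add: upt_conv_Cons del: upt_Suc)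
    have "comps (map h [1..<l]) = id" "comps (map h [Suc (Suc l)..<Suc n]) = id"
      using l assms by (intro h1; auto simp: cyc_succ_def)+
    moreover have "h l = alt4_v ^^ e i"
      using l assms by (intro hv) (auto simp: cyc_succ_def)
    ultimately show ?thesis
      using hx l unfolding sweep split by (simp add: comps_append)
  qed
qed

lemma alt4_power_short_word:
  assumes "n \<ge> 2" and g: "g \<in> carrier (alt4_power n)"
  shows "\<exists>ws. set ws \<subseteq> alt4_gen n ` {1..n} \<and> word_prod (alt4_power n) ws = g \<and> length ws \<le> 10 * n"
proof -
  have "\<forall>i\<in>{1..n}. \<exists>a e b. g i = alt4_x ^^ a \<circ> alt4_v ^^ e \<circ> alt4_x ^^ b"
    using g alt4_normal_form unfolding carrier_alt4_power by (metis PiE_mem)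
  then obtain a e b where
    normal: "\<And>i. i \<in> {1..n} \<Longrightarrow> g i = alt4_x ^^ a i \<circ> alt4_v ^^ e i \<circ> alt4_x ^^ b i"
    by metis
  \<comment> \<open>The power of \<open>alt4_v\<close> must fall between the two powers of
    \<open>alt4_x\<close>: coordinate 1 gets it at the end of the first sweep, the others in the
    second. The outer one gets exponent 0.\<close>
  let ?ws = "alt4_sweep n a (\<lambda>i. if i = 1 then e i else 0) @
    alt4_sweep n b (\<lambda>i. if i = 1 then 0 else e i)"
  have sub: "set ?ws \<subseteq> alt4_gen n ` {1..n}"
    using set_alt4_sweep by simp
  have "word_prod (alt4_power n) ?ws = g"
  proof (rule word_prod_alt4_power_eqI[OF _ g])
    show "set ?ws \<subseteq> carrier (alt4_power n)"
      using sub alt4_gen_carrier by blast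
    show "comps (map (\<lambda>w. w i) ?ws) = g i" if "i \<in> {1..n}" for i
      by (simp add: comps_append comps_alt4_sweep[OF assms(1) that] normal[OF that] o_assoc)
  qed
  moreover have "length ?ws \<le> 10 * n"
  proof -
    have "length ?ws \<le> 5 * n + 5 * n"
      unfolding length_append by (intro add_mono length_alt4_sweep)
    then show ?thesis by simp
  qed
  ultimately show ?thesis
    using sub by blast
qed

lemma alt4_power_1_short_word:
  assumes g: "g \<in> carrier (alt4_power 1)"
  shows "\<exists>ws. set ws \<subseteq> {\<lambda>i\<in>{1}. alt4_x, \<lambda>i\<in>{1}. alt4_v} \<and> word_prod (alt4_power 1) ws = g
    \<and> length ws \<le> 10"
proof -
  have "g 1 \<in> carrier (alt_group 4)"
    using g unfolding carrier_alt4_power by auto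
  then obtain a e b where "a < 3" "e < 2" "b < 3"
    and g1: "g 1 = alt4_x ^^ a \<circ> alt4_v ^^ e \<circ> alt4_x ^^ b"
    by (rule alt4_normal_form)
  let ?x = "\<lambda>i\<in>{1::nat}. alt4_x" and ?v = "\<lambda>i\<in>{1::nat}. alt4_v"
  let ?ws = "replicate a ?x @ replicate e ?v @ replicate b ?x"
  have "word_prod (alt4_power 1) ?ws = g"
  proof (rule word_prod_alt4_power_eqI[OF _ g])
    show "set ?ws \<subseteq> carrier (alt4_power 1)"
      by (auto simp: carrier_alt4_power alt4_x_carrier alt4_v_carrier)
    show "comps (map (\<lambda>w. w i) ?ws) = g i" if "i \<in> {1..1}" for i
      using that g1 by (simp add: comps_append comps_replicate o_assoc)
  qed
  moreover have "length ?ws \<le> 10"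
    using \<open>a < 3\<close> \<open>e < 2\<close> \<open>b < 3\<close> by simp
  ultimately show ?thesis
    by (intro exI[of _ ?ws]) auto
qed

theorem theorem3p3:
  fixes n :: nat
  assumes "n \<ge> 1"
  shows "\<exists>C. generating_set (alt4_power n) C
           \<and> card C = group_rank (alt4_power n)
           \<and> diam (alt4_power n) C \<le> 10 * n"
proof -
  \<comment> \<open>\<open>max n 2\<close> joins the two lower bounds on the rank; the short words
    give both generation and the diameter.\<close>
  obtain C where C: "finite C" "C \<subseteq> carrier (alt4_power n)" "card C = max n 2"
    and short: "\<And>g. g \<in> carrier (alt4_power n) \<Longrightarrow>
      \<exists>ws. set ws \<subseteq> C \<and> word_prod (alt4_power n) ws = g \<and> length ws \<le> 10 * n"
  proof (cases "n = 1")
    case True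
    let ?x = "\<lambda>i\<in>{1::nat}. alt4_x" and ?v = "\<lambda>i\<in>{1::nat}. alt4_v"
    have "?x 1 4 \<noteq> ?v 1 4"
      by simp
    then have "?x \<noteq> ?v"
      by metis
    moreover have "{?x, ?v} \<subseteq> carrier (alt4_power n)"
      using True by (auto simp: carrier_alt4_power alt4_x_carrier alt4_v_carrier)
    ultimately show thesis
      using True alt4_power_1_short_word by (intro that[of "{?x, ?v}"]) simp_all
  next
    case False
    with assms have "n \<ge> 2" by simp
    then show thesis
      using alt4_power_short_word inj_on_alt4_gen alt4_gen_carrier
      by (intro that[of "alt4_gen n ` {1..n}"]) (auto simp: card_image)
  qed
  have gen: "generating_set (alt4_power n) C"
    using C(2) short unfolding generating_set_def by blast
  moreover have "group_rank (alt4_power n) = card C"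
    using C gen alt4_power_rank_ge_n alt4_power_rank_ge_2 assms
    by (intro group_rank_eq_card) auto
  moreover have "diam (alt4_power n) C \<le> 10 * n"
  proof (rule diam_le[OF _ _ short])
    show "finite (carrier (alt4_power n))"
      by (simp add: carrier_alt4_power finite_PiE finite_alt4)
    show "carrier (alt4_power n) \<noteq> {}"
      using alt4_gen_carrier by blast
  qed
  ultimately show ?thesis
    by metis
qed

end
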